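(* There exists $C>0$, only depending on $n$, for which the following statement holds true. Let $r>0$ and $K>0$, and suppose that $$K\ge\frac{C}{r}.$$ For measurable $E\subseteq\mathbb{R}^n$, let $$\mathcal{F}_K(E):=\mathrm{Per}_r(E)-K\,\mathcal{L}^n\big(E\cap(B_r\setminus B_{r/2})\big).$$ Then there exists $E_*\subseteq\mathbb{R}^n$ satisfying $$\mathcal{F}_K(E_* )\le\mathcal{F}_K(E)$$ for any bounded set $E\subseteq\mathbb{R}^n$, and such that $\partial E_*$ is not locally a continuous graph (and, in fact, $\partial E_*$ can be "arbitrarily bad" inside $B_{r/2}$). Moreover, there exists a sequence $E_k\subseteq\mathbb{R}^n$ satisfying $$\mathcal{F}_K(E_k)\le\mathcal{F}_K(E)$$ for any bounded set $E\subseteq\mathbb{R}^n$, and such that $\chi_{E_k}$ is not precompact in $L^1(B_r)$.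
   Context: All sets are measurable. $B_\rho(x)$ is the ball of radius $\rho$ centered at $x$ in $\mathbb{R}^n$, $B_\rho:=B_\rho(0)$, $\mathcal{L}^n$ is the $n$-dimensional Lebesgue measure, and $\chi_E$ is the characteristic function of $E$. For $A\subseteq\mathbb{R}^n$, $A\oplus B_r:=\bigcup_{x\in A}B_r(x)$. Measurable sets are identified with their sets of points of density one, and $\partial E$ denotes the topological boundary of the set of points of density one of $E$. For measurable $E\subseteq\mathbb{R}^n$, $$\mathrm{Per}_r(E):=\frac{1}{2r}\mathcal{L}^n\big((\partial E)\oplus B_r\big).$$ "$\partial E_*$ is locally a continuous graph" means that near each of its points $\partial E_*$ is, in suitable orthonormal coordinates, the graph of a continuous function. "Can be arbitrarily bad inside $B_{r/2}$" means that, for any set $U\subseteq B_{r/2}$ whatsoever (measurable), the set $(B_r\setminus B_{r/2})\cup U$ satisfies the same minimality property, i.e. $\mathcal{F}_K\big((B_r\setminus B_{r/2})\cup U\big)\le\mathcal{F}_K(E)$ for any bounded set $E\subseteq\mathbb{R}^n$, so that the minimizer can be prescribed arbitrarily inside $B_{r/2}$. *)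

theory Defs
  imports "HOL-Analysis.Analysis"
begin

definition density_one_points :: "(real ^ 'n) set \<Rightarrow> (real ^ 'n) set" where
  "density_one_points E =
     {x. ((\<lambda>\<rho>. measure lebesgue (E \<inter> ball x \<rho>) / measure lebesgue (ball x \<rho>)) \<longlongrightarrow> 1) (at_right 0)}"

text \<open>
  A measurable set is identified with its set of points of density one, so its boundary is
  the topological boundary of that set; it depends only on the Lebesgue class of \<open>E\<close>.
\<close>
definition meas_boundary :: "(real ^ 'n) set \<Rightarrow> (real ^ 'n) set" where
  "meas_boundary E = frontier (density_one_points E)"

definition thickening :: "(real ^ 'n) set \<Rightarrow> real \<Rightarrow> (real ^ 'n) set" where
  "thickening A r = (\<Union>x\<in>A. ball x r)"

text \<open>
  The perimeter takes the value \<open>\<infinity>\<close> on some unbounded sets, hence \<^typ>\<open>ennreal\<close>: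
  the real-valued \<^const>\<open>measure\<close> would be 0 there. The functional below is
  correspondingly extended-real-valued; the subtracted term is always finite.
\<close>
definition Per :: "real \<Rightarrow> (real ^ 'n) set \<Rightarrow> ennreal" where
  "Per r E = emeasure lebesgue (thickening (meas_boundary E) r) / ennreal (2 * r)"

definition annulus :: "real \<Rightarrow> (real ^ 'n) set" where
  "annulus r = ball 0 r - ball 0 (r / 2)"

definition energy :: "real \<Rightarrow> real \<Rightarrow> (real ^ 'n) set \<Rightarrow> ereal" where
  "energy r K E = enn2ereal (Per r E) - ereal (K * measure lebesgue (E \<inter> annulus r))"

text \<open>
  The minimizing set itself need not be bounded; only the competitors are.
\<close>
definition minimizes_energy :: "real \<Rightarrow> real \<Rightarrow> (real ^ 'n) set \<Rightarrow> bool" where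
  "minimizes_energy r K M \<longleftrightarrow>
     (\<forall>E :: (real ^ 'n) set. E \<in> sets lebesgue \<and> bounded E \<longrightarrow> energy r K M \<le> energy r K E)"

text \<open>
  Orthonormal coordinates are given by a unit vector \<open>\<nu>\<close> (the last coordinate axis) and its
  orthogonal complement: every point is uniquely \<open>y + t \<nu>\<close> with \<open>y\<close> orthogonal to \<open>\<nu>\<close>. The
  function \<open>g\<close> is defined on a relatively open subset \<open>W\<close> of this hyperplane.
\<close>
definition locally_continuous_graph :: "(real ^ 'n) set \<Rightarrow> bool" where
  "locally_continuous_graph S \<longleftrightarrow>
     (\<forall>p\<in>S. \<exists>\<nu> V W g. norm \<nu> = 1 \<and> open V \<and> p \<in> V \<and>
        openin (top_of_set {y. \<nu> \<bullet> y = 0}) W \<and> continuous_on W (g :: real ^ 'n \<Rightarrow> real) \<and>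
        S \<inter> V = {y + g y *\<^sub>R \<nu> | y. y \<in> W})"

text \<open>
  Relative (sequential) compactness of a family of functions in \<open>L\<^sup>1(\<Omega>)\<close>; the limit
  need not belong to the family.
\<close>
definition precompact_L1 :: "(real ^ 'n) set \<Rightarrow> (real ^ 'n \<Rightarrow> real) set \<Rightarrow> bool" where
  "precompact_L1 \<Omega> F \<longleftrightarrow>
     (\<forall>f :: nat \<Rightarrow> real ^ 'n \<Rightarrow> real. range f \<subseteq> F \<longrightarrow>
        (\<exists>g s. set_integrable lebesgue \<Omega> g \<and> strict_mono s \<and>
           (\<lambda>k. \<integral>\<^sup>+x\<in>\<Omega>. ennreal \<bar>f (s k) x - g x\<bar> \<partial>lebesgue) \<longlonglongrightarrow> 0))"

end

theory Submission
  imports Defs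
begin

text \<open>
  Write \<open>A\<close> for the annulus, \<open>D\<close> for the density one points of a bounded competitor \<open>E\<close>, and \<open>N\<close> for
  the \<open>r\<close>-thickening of the frontier of \<open>D\<close>. A set \<open>M = A \<union> U\<close> with \<open>U \<subseteq> B\<^bsub>r/2\<^esub>\<close> lies in the closed
  ball of radius \<open>r\<close>, so the thickening of its boundary lies in \<open>B\<^bsub>2r\<^esub>\<close>, whatever \<open>U\<close> is. Hence
  all such \<open>M\<close> minimize once every bounded \<open>E\<close> satisfies
  \<open>|B\<^bsub>2r\<^esub>| \<le> 4\<^sup>n |A - E| + |N|\<close>: a competitor that saves perimeter must give up
  a proportional amount of the rewarded annulus. This gives \<open>C = 4\<^sup>n / 2\<close>.

  The inequality (\<open>ball_le_thickened_frontier\<close>) comes from looking at one ray from the origin at a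
  time. On a ray, stretch the outer half \<open>(r/2, r)\<close> onto \<open>(0, 2r)\<close>; a point \<open>x\<close> of
  \<open>B\<^bsub>2r\<^esub>\<close> whose preimage misses the closure of \<open>D\<close> is paid for by \<open>A - D\<close>, up to the factor \<open>4\<^sup>n\<close>.
  Otherwise \<open>D\<close> is bounded and so has a frontier point farther out on the same ray. The thickening
  contains a segment of length \<open>2r\<close> around that point, so some outward translate of \<open>x\<close> along the ray
  by a multiple of \<open>2r\<close> (in fact of \<open>2s\<close> with \<open>s < r\<close>, to stay clear of the ends of the
  segment) belongs to \<open>N\<close>. Pulling points back towards the origin by a fixed length \<open>c\<close> is the map
  \<open>z \<mapsto> z - P z\<close>, with \<open>P\<close> the nearest point projection onto the ball of radius \<open>c\<close>. This map
  does not increase distances, hence not volumes, so the parts of \<open>N\<close> in the disjoint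
  shells \<open>2sk \<le> |z| < 2s(k+1)\<close> pay for the rest of \<open>B\<^bsub>2s\<^esub>\<close>.

  Two facts of measure theory are needed: a Lipschitz map with constant \<open>L\<close> multiplies volume by at
  most \<open>L\<^sup>n\<close>, and almost every point of \<open>E\<close> is a point of density one, so that \<open>|A - D| \<le> |A - E|\<close>.
  Both follow from the Vitali covering theorem.

  The freedom in \<open>U\<close> then gives the remaining claims. If \<open>U\<close> consists of shells accumulating at the
  origin, the boundary meets every ray arbitrarily close to its point \<open>0\<close>, so no direction can be the
  vertical axis of a graph there. If \<open>U\<close> is the part of \<open>B\<^bsub>r/2\<^esub>\<close> where the \<open>k\<close>-th binary digit of a
  rescaled coordinate is \<open>1\<close>, then any two of the minimizers stay a fixed distance apart in \<open>L\<^sup>1\<close>.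
\<close>

section \<open>Density points and Lipschitz images\<close>

text \<open>
  The common part of the two applications of the Vitali covering theorem below: if each ball of a fine cover
  carries a set whose measure is controlled by that of the ball, disjointness of the selected
  balls turns this into a global bound.
\<close>
lemma vitali_comparison:
  fixes S T :: "'a::euclidean_space set" and U :: "'a \<times> real \<Rightarrow> 'b::euclidean_space set"
  assumes T: "T \<in> lmeasurable" and c: "0 \<le> c"
    and U: "\<And>i. i \<in> K \<Longrightarrow> U i \<in> lmeasurable"
    and le: "\<And>i. i \<in> K \<Longrightarrow> measure lebesgue (U i) \<le> c * measure lebesgue (ball (fst i) (snd i))"
    and sub: "\<And>i. i \<in> K \<Longrightarrow> ball (fst i) (snd i) \<subseteq> T"
    and fine: "\<And>x d. \<lbrakk>x \<in> S; 0 < d\<rbrakk> \<Longrightarrow> \<exists>i\<in>K. x \<in> ball (fst i) (snd i) \<and> snd i < d"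
  obtains C where "C \<subseteq> K" "negligible (S - (\<Union>i\<in>C. ball (fst i) (snd i)))"
    "(\<Union>i\<in>C. U i) \<in> lmeasurable" "measure lebesgue (\<Union>i\<in>C. U i) \<le> c * measure lebesgue T"
proof -
  obtain C where C: "countable C" "C \<subseteq> K"
    and disj: "pairwise (\<lambda>i j. disjnt (ball (fst i) (snd i)) (ball (fst j) (snd j))) C"
    and neg: "negligible (S - (\<Union>i\<in>C. ball (fst i) (snd i)))"
    using Vitali_covering_theorem_balls[of S K fst snd] fine by (metis (no_types, lifting))
  have bound: "measure lebesgue (\<Union>i\<in>I. U i) \<le> c * measure lebesgue T"
    if I: "I \<subseteq> C" "finite I" for I
  proof -
    have "measure lebesgue (\<Union>i\<in>I. U i) \<le> (\<Sum>i\<in>I. measure lebesgue (U i))"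
      using I C U by (intro measure_UNION_le) (auto dest!: fmeasurableD)
    also have "\<dots> \<le> (\<Sum>i\<in>I. c * measure lebesgue (ball (fst i) (snd i)))"
      using I C le by (intro sum_mono) auto
    also have "\<dots> = c * measure lebesgue (\<Union>i\<in>I. ball (fst i) (snd i))"
      using I disj by (subst measure_UNION') (auto simp: sum_distrib_left elim: pairwise_mono)
    also have "\<dots> \<le> c * measure lebesgue T"
      using I C sub c by (intro mult_left_mono measure_mono_fmeasurable T sets.finite_UN) fastforce+
    finally show ?thesis .
  qed
  have "(\<Union>i\<in>C. U i) \<in> lmeasurable" "measure lebesgue (\<Union>i\<in>C. U i) \<le> c * measure lebesgue T"
    using C U bound
    by (auto intro!: fmeasurable_UN_bound[OF C(1)] measure_UN_bound[OF C(1)])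
  with that C(2) neg show thesis by blast
qed

text \<open>
  Covering \<open>S\<close> by disjoint balls inside an open set barely larger than \<open>S\<close> in outer measure
  gives \<open>\<mu>(S) \<le> c \<mu>(S)\<close> for the outer measure \<open>\<mu>\<close>. The outer measure is
  used because the exceptional sets of the density theorem come from a quantifier over uncountably many radii.
\<close>
lemma negligible_if_uniformly_sparse:
  fixes S E :: "'a::euclidean_space set"
  assumes "bounded S" "S \<subseteq> E" "E \<in> sets lebesgue" "0 \<le> c" "c < 1"
    and sparse: "\<And>x d. \<lbrakk>x \<in> S; 0 < d\<rbrakk> \<Longrightarrow> \<exists>\<rho>. 0 < \<rho> \<and> \<rho> < d \<and>
        measure lebesgue (E \<inter> ball x \<rho>) \<le> c * measure lebesgue (ball x \<rho>)"
  shows "negligible S"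
proof -
  \<comment> \<open>A measurable hull of \<open>S\<close>, which represents its outer measure.\<close>
  obtain H where H: "H \<in> sets lebesgue" "S \<subseteq> H" "outer_measure_of lebesgue S = emeasure lebesgue H"
    using outer_measure_of_attain[of S lebesgue] by auto
  obtain a where a: "S \<subseteq> ball 0 a"
    using \<open>bounded S\<close> bounded_subset_ballD by blast
  have "emeasure lebesgue H \<le> emeasure lebesgue (ball (0::'a) a)"
    unfolding H(3)[symmetric] using outer_measure_of_mono[OF a, of lebesgue] by simp
  then have Hf: "H \<in> lmeasurable"
    using H(1) fmeasurableD2[OF lmeasurable_ball[of "0::'a" a]]
    by (intro fmeasurableI) (auto simp: less_top neq_top_trans)
  have minimal: "measure lebesgue H \<le> measure lebesgue V" if "S \<subseteq> V" "V \<in> lmeasurable" for V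
  proof -
    have "emeasure lebesgue H \<le> emeasure lebesgue V"
      unfolding H(3)[symmetric] using outer_measure_of_mono[OF that(1), of lebesgue] that(2)
      by (simp add: fmeasurableD)
    then show ?thesis
      using Hf that(2) by (simp add: emeasure_eq_measure2)
  qed
  have step: "measure lebesgue H \<le> c * measure lebesgue H + e" if "e > 0" for e
  proof -
    obtain T where T: "open T" "H \<subseteq> T" "T - H \<in> lmeasurable" "emeasure lebesgue (T - H) < ennreal e"
      using sets_lebesgue_outer_open[OF H(1) \<open>e > 0\<close>] by blast
    have TH: "T = H \<union> (T - H)" using T by auto
    have Tm: "T \<in> lmeasurable"
      by (subst TH) (intro fmeasurable.Un Hf T)
    have "measure lebesgue (T - H) \<le> e"
      using T(3,4) by (simp add: emeasure_eq_measure2 ennreal_less_iff)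
    then have Te: "measure lebesgue T \<le> measure lebesgue H + e"
      using measure_Un_le[of H lebesgue "T - H"] TH Hf T(3) by (metis add_left_mono fmeasurableD order_trans)
    define K where "K = {i. fst i \<in> S \<and> 0 < snd i \<and> ball (fst i) (snd i) \<subseteq> T \<and>
       measure lebesgue (E \<inter> ball (fst i) (snd i)) \<le> c * measure lebesgue (ball (fst i) (snd i))}"
    have meas: "E \<inter> ball x d \<in> lmeasurable" for x d
      by (metis assms(3) fmeasurable_Int_fmeasurable inf_commute lmeasurable_ball)
    have fine: "\<exists>i\<in>K. x \<in> ball (fst i) (snd i) \<and> snd i < d" if xd: "x \<in> S" "0 < d" for x d
    proof -
      obtain k where k: "k > 0" "ball x k \<subseteq> T"
        using T(1,2) H(2) xd(1) by (meson openE subsetD)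
      obtain \<rho> where \<rho>: "0 < \<rho>" "\<rho> < min d k"
        "measure lebesgue (E \<inter> ball x \<rho>) \<le> c * measure lebesgue (ball x \<rho>)"
        using sparse[of x "min d k"] xd k by auto
      have "ball x \<rho> \<subseteq> T" using \<rho> k by (auto simp: subset_iff)
      then show ?thesis
        using \<rho> xd by (intro bexI[of _ "(x,\<rho>)"]) (auto simp: K_def)
    qed
    obtain C where C: "negligible (S - (\<Union>i\<in>C. ball (fst i) (snd i)))"
      "(\<Union>i\<in>C. E \<inter> ball (fst i) (snd i)) \<in> lmeasurable"
      "measure lebesgue (\<Union>i\<in>C. E \<inter> ball (fst i) (snd i)) \<le> c * measure lebesgue T"
      by (rule vitali_comparison[of T c K "\<lambda>i. E \<inter> ball (fst i) (snd i)" S])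
        (use Tm \<open>0 \<le> c\<close> meas fine in \<open>auto simp: K_def\<close>)
    let ?V = "\<Union>i\<in>C. E \<inter> ball (fst i) (snd i)" and ?N = "S - (\<Union>i\<in>C. ball (fst i) (snd i))"
    have "measure lebesgue H \<le> measure lebesgue (?V \<union> ?N)"
      using \<open>S \<subseteq> E\<close>
      by (intro minimal fmeasurable.Un[OF C(2) negligible_imp_measurable[OF C(1)]]) auto
    also have "\<dots> \<le> measure lebesgue ?V + measure lebesgue ?N"
      using fmeasurableD[OF C(2)] negligible_imp_sets[OF C(1)] by (rule measure_Un_le)
    also have "\<dots> \<le> c * (measure lebesgue H + e)"
      using negligible_imp_measure0[OF C(1)] order_trans[OF C(3) mult_left_mono[OF Te \<open>0 \<le> c\<close>]]
      by linarith
    also have "\<dots> \<le> c * measure lebesgue H + e"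
      using \<open>c < 1\<close> \<open>e > 0\<close> by (simp add: distrib_left)
    finally show ?thesis .
  qed
  have "measure lebesgue H \<le> c * measure lebesgue H"
    by (rule field_le_epsilon) (use step in auto)
  then have "measure lebesgue H = 0"
    using \<open>c < 1\<close> by (smt (verit) measure_nonneg mult_le_cancel_right1)
  then have "negligible H"
    using Hf negligible_iff_measure by blast
  then show ?thesis using H(2) negligible_subset by blast
qed

text \<open>
  A point of \<open>E\<close> that is not of density one sees, for some \<open>m\<close>, density at most \<open>1 - 1/(m+1)\<close>
  at arbitrarily small scales, so it lies in one of countably many negligible sets.
\<close>
theorem lebesgue_density:
  fixes E :: "(real ^ 'n) set"
  assumes E: "E \<in> sets lebesgue"
  shows "negligible (E - density_one_points E)"
proof -
  define q where "q x \<rho> = measure lebesgue (E \<inter> ball x \<rho>) / measure lebesgue (ball x \<rho>)" for x \<rho>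
  have q1: "q x \<rho> \<le> 1" for x \<rho>
  proof -
    have "measure lebesgue (E \<inter> ball x \<rho>) \<le> measure lebesgue (ball x \<rho>)"
      using E by (intro measure_mono_fmeasurable) auto
    then show ?thesis
      unfolding q_def by (smt (verit) divide_le_eq_1 measure_nonneg)
  qed
  define S where "S m = {x \<in> E \<inter> ball 0 (real m). \<forall>d>0. \<exists>\<rho>. 0 < \<rho> \<and> \<rho> < d \<and>
     q x \<rho> \<le> 1 - 1 / real (Suc m)}" for m
  have "negligible (S m)" for m
  proof (rule negligible_if_uniformly_sparse[where E = E and c = "1 - 1 / real (Suc m)"])
    show "bounded (S m)"
      by (rule bounded_subset[OF bounded_ball[of 0 "real m"]]) (auto simp: S_def)
    show "\<exists>\<rho>>0. \<rho> < d \<and> measure lebesgue (E \<inter> ball x \<rho>) \<le> (1 - 1 / real (Suc m)) * measure lebesgue (ball x \<rho>)"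
      if "x \<in> S m" "0 < d" for x d
    proof -
      have "\<forall>d>0. \<exists>\<rho>>0. \<rho> < d \<and> q x \<rho> \<le> 1 - 1 / real (Suc m)"
        using that(1) unfolding S_def mem_Collect_eq by (rule conjunct2)
      then obtain \<rho> where \<rho>: "0 < \<rho>" "\<rho> < d" "q x \<rho> \<le> 1 - 1 / real (Suc m)"
        using \<open>0 < d\<close> by meson
      have "0 < measure lebesgue (ball x \<rho>)" using content_ball_pos[OF \<rho>(1), of x] by simp
      then have "measure lebesgue (E \<inter> ball x \<rho>) \<le> (1 - 1 / real (Suc m)) * measure lebesgue (ball x \<rho>)"
        using \<rho>(3) unfolding q_def by (simp only: pos_divide_le_eq)
      with \<rho>(1,2) show ?thesis by blast
    qed
  qed (use E in \<open>auto simp: S_def simp del: of_nat_Suc\<close>)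
  then have "negligible (\<Union>m. S m)"
    by (rule negligible_Union_nat)
  moreover have "E - density_one_points E \<subseteq> (\<Union>m. S m)"
  proof
    fix x assume x: "x \<in> E - density_one_points E"
    then have "\<not> (q x \<longlongrightarrow> 1) (at_right 0)"
      unfolding density_one_points_def q_def by simp
    then obtain e where e: "e > 0" "\<not> (\<forall>\<^sub>F \<rho> in at_right 0. dist (q x \<rho>) 1 < e)"
      unfolding tendsto_iff by blast
    obtain m where m: "real m > norm x" "real m > 1 / e"
      by (meson less_le_trans linear nle_le reals_Archimedean2)
    have "1 / real (Suc m) \<le> e"
      using m e by (simp add: field_simps) 
    moreover have "\<exists>\<rho>>0. \<rho> < d \<and> q x \<rho> \<le> 1 - e" if "d > 0" for d
    proof (rule ccontr)
      assume "\<not> ?thesis"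
      then have "\<forall>\<rho>>0. \<rho> < d \<longrightarrow> dist (q x \<rho>) 1 < e"
        using q1[of x] unfolding dist_real_def by (smt (verit))
      then have "\<forall>\<^sub>F \<rho> in at_right 0. dist (q x \<rho>) 1 < e"
        using that unfolding eventually_at_right_field by auto
      with e show False by blast
    qed
    ultimately have "\<forall>d>0. \<exists>\<rho>>0. \<rho> < d \<and> q x \<rho> \<le> 1 - 1 / real (Suc m)"
      by (meson diff_left_mono order_trans)
    then have "x \<in> S m"
      using x m(1) by (simp add: S_def)
    then show "x \<in> (\<Union>m. S m)" by blast
  qed
  ultimately show ?thesis using negligible_subset by blast
qed

text \<open>
  The image of a ball lies in a ball with radius \<open>L\<close> times as large, and the points that the Vitali
  cover leaves out form a null set, whose image is again null. The measurable
  superset \<open>V\<close> expresses a bound on the outer measure of the image.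
\<close>
lemma lipschitz_image_measure_cover:
  fixes f :: "'a::euclidean_space \<Rightarrow> 'a"
  assumes lip: "L-lipschitz_on UNIV f" and S: "S \<in> lmeasurable" and "e > 0"
  obtains V where "f ` S \<subseteq> V" "V \<in> lmeasurable"
    "measure lebesgue V \<le> L ^ DIM('a) * measure lebesgue S + e"
proof -
  have L: "0 \<le> L" using lip lipschitz_on_nonneg by blast
  define e' where "e' = e / (L ^ DIM('a) + 1)"
  have pos: "L ^ DIM('a) + 1 > 0" using L by (simp add: add_nonneg_pos)
  have e': "e' > 0" "L ^ DIM('a) * e' \<le> e"
    using \<open>e > 0\<close> L pos unfolding e'_def by (auto simp: field_simps)
  obtain T where T: "open T" "S \<subseteq> T" "T - S \<in> lmeasurable" "emeasure lebesgue (T - S) < ennreal e'"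
    using sets_lebesgue_outer_open[OF fmeasurableD[OF S] e'(1)] by blast
  have TS: "T = S \<union> (T - S)" using T by auto
  have Tm: "T \<in> lmeasurable"
    by (subst TS) (intro fmeasurable.Un S T)
  have "measure lebesgue (T - S) \<le> e'"
    using T(3,4) by (simp add: emeasure_eq_measure2 ennreal_less_iff)
  then have Te: "measure lebesgue T \<le> measure lebesgue S + e'"
    using measure_Un_le[of S lebesgue "T - S"] TS S T(3) by (metis add_left_mono fmeasurableD order_trans)
  define K where "K = {i. 0 < snd i \<and> ball (fst i) (snd i) \<subseteq> T}"
  define U where "U i = cball (f (fst i)) (L * snd i)" for i :: "'a \<times> real"
  have fine: "\<exists>i\<in>K. x \<in> ball (fst i) (snd i) \<and> snd i < d" if xd: "x \<in> S" "0 < d" for x d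
  proof -
    obtain k where k: "k > 0" "ball x k \<subseteq> T"
      using T(1,2) xd(1) by (meson openE subsetD)
    have "ball x (min (d/2) k) \<subseteq> T" using k by (auto simp: subset_iff)
    then show ?thesis
      using xd k by (intro bexI[of _ "(x,min (d/2) k)"]) (auto simp: K_def)
  qed
  have vol: "measure lebesgue (U i) \<le> L ^ DIM('a) * measure lebesgue (ball (fst i) (snd i))"
    if "i \<in> K" for i
  proof -
    have "0 \<le> L * snd i" "0 \<le> snd i" using that L by (auto simp: K_def)
    then show ?thesis
      unfolding U_def
      using content_cball_conv_ball[of "f (fst i)" "L * snd i"] content_ball_conv_unit_ball[of "L * snd i" "f (fst i)"]
        content_ball_conv_unit_ball[of "snd i" "fst i"]
      by (simp add: power_mult_distrib)
  qed
  obtain C where C: "C \<subseteq> K" "negligible (S - (\<Union>i\<in>C. ball (fst i) (snd i)))"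
    "(\<Union>i\<in>C. U i) \<in> lmeasurable"
    "measure lebesgue (\<Union>i\<in>C. U i) \<le> L ^ DIM('a) * measure lebesgue T"
    by (rule vitali_comparison[of T "L ^ DIM('a)" K U S])
      (use Tm L vol fine in \<open>auto simp: K_def U_def\<close>)
  let ?N = "S - (\<Union>i\<in>C. ball (fst i) (snd i))"
  have negf: "negligible (f ` ?N)"
    using C(2) lip
    by (intro negligible_locally_Lipschitz_image)
      (auto intro!: exI[of _ UNIV] exI[of _ L] simp: lipschitz_on_def dist_norm)
  show thesis
  proof
    show "f ` S \<subseteq> (\<Union>i\<in>C. U i) \<union> f ` ?N"
    proof
      fix y assume "y \<in> f ` S"
      then obtain x where x: "x \<in> S" "y = f x" by blast
      show "y \<in> (\<Union>i\<in>C. U i) \<union> f ` ?N"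
      proof (cases "x \<in> ?N")
        case False
        then obtain i where i: "i \<in> C" "dist (fst i) x < snd i" using x by auto
        have "dist (f (fst i)) (f x) \<le> L * dist (fst i) x"
          using lip by (auto simp: lipschitz_on_def)
        also have "\<dots> \<le> L * snd i" using i L by (intro mult_left_mono) auto
        finally show ?thesis using i x by (auto simp: U_def)
      qed (use x in auto)
    qed
    show "(\<Union>i\<in>C. U i) \<union> f ` ?N \<in> lmeasurable"
      using C(3) negligible_imp_measurable[OF negf] by (rule fmeasurable.Un)
    have "measure lebesgue ((\<Union>i\<in>C. U i) \<union> f ` ?N) \<le> measure lebesgue (\<Union>i\<in>C. U i) + measure lebesgue (f ` ?N)"
      using fmeasurableD[OF C(3)] negligible_imp_sets[OF negf] by (rule measure_Un_le)
    also have "\<dots> \<le> L ^ DIM('a) * (measure lebesgue S + e')"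
      using negligible_imp_measure0[OF negf]
        order_trans[OF C(4) mult_left_mono[OF Te zero_le_power[OF L]]]
      by linarith
    also have "\<dots> \<le> L ^ DIM('a) * measure lebesgue S + e"
      using e' by (simp add: distrib_left)
    finally show "measure lebesgue ((\<Union>i\<in>C. U i) \<union> f ` ?N) \<le> L ^ DIM('a) * measure lebesgue S + e" .
  qed
qed

section \<open>Transport along rays\<close>

text \<open>
  Nearest point projections \<open>P\<close> onto convex sets are firmly nonexpansive: \<open>z - P z\<close> and \<open>P z\<close> have
  increments with nonnegative inner product; the first is thus no longer than their sum.
\<close>
lemma residual_closest_point_lipschitz:
  fixes S :: "'a::euclidean_space set"
  assumes S: "convex S" "closed S" "S \<noteq> {}"
  shows "1-lipschitz_on UNIV (\<lambda>z. z - closest_point S z)"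
proof (rule lipschitz_onI)
  fix x y :: 'a
  let ?p = "closest_point S x" and ?q = "closest_point S y"
  have "(x - ?p) \<bullet> (?q - ?p) \<le> 0" "(y - ?q) \<bullet> (?p - ?q) \<le> 0"
    using S by (simp_all add: closest_point_dot closest_point_in_set)
  then have "0 \<le> ((x - ?p) - (y - ?q)) \<bullet> (?p - ?q)"
    by (simp add: inner_diff inner_commute)
  then have "norm ((x - ?p) - (y - ?q)) \<le> norm (((x - ?p) - (y - ?q)) + (?p - ?q))"
    unfolding norm_le
    using inner_ge_zero[of "?p - ?q"]
    by (simp only: inner_add_left inner_add_right inner_commute[of "?p - ?q" "x - ?p - (y - ?q)"])
  then show "dist (x - ?p) (y - ?q) \<le> 1 * dist x y"
    by (simp add: dist_norm)
qed simp

lemma closest_point_cball_ray: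
  fixes \<theta> :: "'a::euclidean_space"
  assumes "norm \<theta> = 1" "0 \<le> c" "c \<le> t"
  shows "closest_point (cball 0 c) (t *\<^sub>R \<theta>) = c *\<^sub>R \<theta>"
proof (rule closest_point_unique[symmetric])
  show "\<forall>z\<in>cball 0 c. dist (t *\<^sub>R \<theta>) (c *\<^sub>R \<theta>) \<le> dist (t *\<^sub>R \<theta>) z"
  proof
    fix z :: 'a assume "z \<in> cball 0 c"
    then have "t - c \<le> norm (t *\<^sub>R \<theta>) - norm z" using assms by simp
    also have "\<dots> \<le> dist (t *\<^sub>R \<theta>) z" unfolding dist_norm by (rule norm_triangle_ineq2)
    finally show "dist (t *\<^sub>R \<theta>) (c *\<^sub>R \<theta>) \<le> dist (t *\<^sub>R \<theta>) z"
      using assms by (simp add: dist_norm flip: scaleR_left_diff_distrib)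
  qed
qed (use assms in auto)

text \<open>
  On each ray the residual of the projection onto a centred ball is the inward translation by the radius.
\<close>
lemma residual_cball_ray:
  fixes \<theta> :: "'a::euclidean_space"
  assumes "norm \<theta> = 1" "0 \<le> c" "0 \<le> t"
  shows "(t + c) *\<^sub>R \<theta> - closest_point (cball 0 c) ((t + c) *\<^sub>R \<theta>) = t *\<^sub>R \<theta>"
  using closest_point_cball_ray[of \<theta> c "t + c"] assms by (simp add: scaleR_left_distrib)

lemma frontier_beyond_on_ray:
  fixes \<theta> :: "'a::real_normed_vector"
  assumes "bounded D" "norm \<theta> = 1" "t *\<^sub>R \<theta> \<in> closure D" "0 \<le> t"
  obtains \<rho> where "t \<le> \<rho>" "\<rho> *\<^sub>R \<theta> \<in> frontier D"
proof (cases "t *\<^sub>R \<theta> \<in> D")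
  case False
  then have "t *\<^sub>R \<theta> \<in> frontier D"
    using assms(3) interior_subset by (auto simp: frontier_def)
  then show thesis using that by blast
next
  case True
  obtain b where b: "D \<subseteq> ball 0 b" using assms(1) bounded_subset_ballD by blast
  define R where "R = (\<lambda>u. u *\<^sub>R \<theta>) ` {t..max t b}"
  have "connected R"
    unfolding R_def by (intro connected_continuous_image continuous_intros) auto
  moreover have "t *\<^sub>R \<theta> \<in> R \<inter> D" using True by (auto simp: R_def)
  then have "R \<inter> D \<noteq> {}" by blast
  moreover have "max t b *\<^sub>R \<theta> \<in> R - D"
    using b assms(2,4) by (auto simp: R_def abs_if dest!: subsetD)
  then have "R - D \<noteq> {}" by blast
  ultimately have "R \<inter> frontier D \<noteq> {}" by (rule connected_Int_frontier)
  then show thesis using that by (auto simp: R_def)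
qed

lemma open_thickening: "open (thickening A r)"
  unfolding thickening_def by auto

lemma bounded_thickening:
  assumes "bounded A"
  shows "bounded (thickening A r)"
proof -
  obtain b where b: "A \<subseteq> ball 0 b" using assms bounded_subset_ballD by blast
  have "thickening A r \<subseteq> ball 0 (b + r)"
  proof
    fix x assume "x \<in> thickening A r"
    then obtain a where "a \<in> A" "dist a x < r" by (auto simp: thickening_def)
    then show "x \<in> ball 0 (b + r)"
      using b dist_triangle[of 0 x a] by fastforce
  qed
  then show ?thesis using bounded_ball bounded_subset by blast
qed

text \<open>
  The alternative on a single ray. Either the point of the annulus corresponding to \<open>x\<close> is missed
  by the closure of \<open>D\<close>, or \<open>D\<close> has a frontier point beyond it, and an outward translate of \<open>x\<close> by
  a multiple of \<open>2s\<close> falls within \<open>r\<close> of that frontier point.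
\<close>
lemma radial_transport_cover:
  fixes D :: "(real ^ 'n) set"
  assumes D: "bounded D" and s: "0 < s" "s < r" and x: "x \<in> ball 0 (2 * s)"
  defines "N \<equiv> thickening (frontier D) r"
    and "g \<equiv> \<lambda>c (z :: real ^ 'n). z - closest_point (cball 0 c) z"
    and "Sh \<equiv> \<lambda>k. {z :: real ^ 'n. 2 * s * real k \<le> norm z \<and> norm z < 2 * s * real (Suc k)}"
  shows "x \<in> (\<lambda>z. 4 *\<^sub>R g (r / 2) z) ` (annulus r - closure D) \<or>
     (\<exists>k. x \<in> g (2 * s * real k) ` (N \<inter> Sh k))"
proof -
  define t where "t = norm x"
  have t: "0 \<le> t" "t < 2 * s" using x by (auto simp: t_def)
  obtain \<theta> where \<theta>: "norm \<theta> = 1" "x = t *\<^sub>R \<theta>"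
  proof (cases "x = 0")
    case True
    obtain \<theta> :: "real ^ 'n" where "norm \<theta> = 1" using vector_choose_size[of 1] by auto
    with True that show thesis by (simp add: t_def)
  next
    case False
    then show thesis using that[of "x /\<^sub>R norm x"] by (simp add: t_def)
  qed
  define y where "y = (t / 4 + r / 2) *\<^sub>R \<theta>"
  show ?thesis
  proof (cases "y \<in> closure D")
    case False
    have "norm y = t / 4 + r / 2" using \<theta> t s by (simp add: y_def)
    then have "y \<in> annulus r" using t s by (auto simp: annulus_def)
    moreover have "x = 4 *\<^sub>R g (r / 2) y"
      using residual_cball_ray[of \<theta> "r / 2" "t / 4"] \<theta> t s by (simp add: g_def y_def)
    ultimately show ?thesis using False by blast
  next
    case True
    then obtain \<rho> where \<rho>: "t / 4 + r / 2 \<le> \<rho>" "\<rho> *\<^sub>R \<theta> \<in> frontier D"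
      using frontier_beyond_on_ray[OF D \<theta>(1)] t s unfolding y_def
      by (metis add_nonneg_nonneg divide_nonneg_nonneg less_eq_real_def less_trans zero_le_numeral)
    \<comment> \<open>If \<open>t \<le> \<rho>\<close>, translates of \<open>t\<close> by steps \<open>2s\<close> come within \<open>s\<close> of \<open>\<rho>\<close>. If \<open>\<rho> < t\<close>, no translation
      is needed, as \<open>t - \<rho> \<le> 3t/4 - r/2 < 3s/2 - r/2 < r\<close>.\<close>
    obtain k :: nat where k: "\<bar>t + 2 * s * real k - \<rho>\<bar> < r"
    proof (cases "t \<le> \<rho>")
      case False
      then show thesis using that[of 0] \<rho> t s by simp
    next
      case True
      define q where "q = (\<rho> - t + s) / (2 * s)"
      have "0 \<le> q" using True s by (simp add: q_def)
      then have "real (nat \<lfloor>q\<rfloor>) \<le> q" "q < real (nat \<lfloor>q\<rfloor>) + 1" by linarith+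
      then have "2 * s * real (nat \<lfloor>q\<rfloor>) \<le> \<rho> - t + s" "\<rho> - t + s < 2 * s * (real (nat \<lfloor>q\<rfloor>) + 1)"
        using s by (simp_all add: q_def pos_le_divide_eq pos_divide_less_eq mult.commute)
      then show thesis using that[of "nat \<lfloor>q\<rfloor>"] s by (simp add: abs_if algebra_simps)
    qed
    define z where "z = (t + 2 * s * real k) *\<^sub>R \<theta>"
    have c: "0 \<le> 2 * s * real k" using s by simp
    have nz: "norm z = t + 2 * s * real k" using \<theta> t c by (simp add: z_def)
    have "dist (\<rho> *\<^sub>R \<theta>) z = \<bar>t + 2 * s * real k - \<rho>\<bar>"
      using \<theta> unfolding z_def dist_norm by (simp add: abs_minus_commute flip: scaleR_left_diff_distrib)
    then have "z \<in> ball (\<rho> *\<^sub>R \<theta>) r" using k by simp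
    then have "z \<in> N" using \<rho>(2) unfolding N_def thickening_def by blast
    moreover have "z \<in> Sh k" using nz t c s by (simp add: Sh_def algebra_simps)
    moreover have "x = g (2 * s * real k) z"
      using residual_cball_ray[OF \<theta>(1) c t(1)] \<theta> by (simp add: g_def z_def)
    ultimately show ?thesis by blast
  qed
qed

lemma measure_Int_add_Diff:
  assumes "A \<in> fmeasurable M" "E \<in> sets M"
  shows "measure M A = measure M (A \<inter> E) + measure M (A - E)"
  using measure_Un2[OF fmeasurable_Int_fmeasurable[OF assms] assms(1)]
  by (simp add: Un_absorb1 Diff_Int)

lemma lmeasurable_annulus: "annulus r \<in> lmeasurable"
  unfolding annulus_def by (intro fmeasurable_Diff) auto

text \<open>
  Summing the transport over the shells, of which only finitely many meet the bounded set \<open>N\<close>.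
\<close>
lemma smaller_ball_le_thickened_frontier:
  fixes D :: "(real ^ 'n) set"
  assumes D: "bounded D" and s: "0 < s" "s < r"
  shows "measure lebesgue (ball (0 :: real ^ 'n) (2 * s)) \<le>
     4 ^ CARD('n) * measure lebesgue (annulus r - closure D) +
     measure lebesgue (thickening (frontier D) r)"
proof -
  define N where "N = thickening (frontier D) r"
  define g where "g = (\<lambda>c (z :: real ^ 'n). z - closest_point (cball 0 c) z)"
  define Sh where "Sh = (\<lambda>k. {z :: real ^ 'n. 2 * s * real k \<le> norm z \<and> norm z < 2 * s * real (Suc k)})"
  define A where "A = annulus r - closure D"
  have N: "bounded N" "open N"
    using D by (auto simp: N_def open_thickening bounded_closure frontier_def
        intro!: bounded_thickening bounded_diff)
  then have Nm: "N \<in> lmeasurable" by (simp add: lmeasurable_open)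
  have Am: "A \<in> lmeasurable"
    unfolding A_def by (intro fmeasurable_Diff lmeasurable_annulus) auto
  have Shm: "Sh k \<in> sets lebesgue" for k
  proof -
    have "Sh k = ball 0 (2 * s * real (Suc k)) - ball 0 (2 * s * real k)" by (auto simp: Sh_def)
    then show ?thesis by simp
  qed
  have NSh: "N \<inter> Sh k \<in> lmeasurable" for k
    using fmeasurable_Int_fmeasurable[OF Nm Shm] .
  obtain b where b: "N \<subseteq> ball 0 b" using N bounded_subset_ballD by blast
  obtain m :: nat where m: "b < real m * (2 * s)" using s reals_Archimedean3[of "2 * s"] by auto
  have empty: "N \<inter> Sh k = {}" if "k \<ge> m" for k
  proof -
    have "real m * (2 * s) \<le> real k * (2 * s)" using that s by (intro mult_right_mono) auto
    then have "b < 2 * s * real k" using m by (simp only: mult.commute[of "2 * s"] less_le_trans)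
    with b show ?thesis by (fastforce simp: Sh_def)
  qed
  have lip1: "1-lipschitz_on UNIV (g c)" if "c \<ge> 0" for c
    unfolding g_def using that by (intro residual_closest_point_lipschitz) auto
  have lip4: "4-lipschitz_on UNIV (\<lambda>z. 4 *\<^sub>R g (r / 2) z)"
    using lipschitz_on_cmult[OF lip1, of "r / 2" 4] s by simp
  have disj: "disjnt (Sh i) (Sh j)" if "i < j" for i j
  proof -
    have "2 * s * real (Suc i) \<le> 2 * s * real j" using that s by (intro mult_left_mono) auto
    then show ?thesis by (force simp: disjnt_iff Sh_def)
  qed
  have "measure lebesgue (ball (0 :: real ^ 'n) (2 * s)) \<le>
     4 ^ CARD('n) * measure lebesgue A + measure lebesgue N + real (m + 1) * e" if e: "e > 0" for e
  proof -
    obtain V where V: "(\<lambda>z. 4 *\<^sub>R g (r / 2) z) ` A \<subseteq> V" "V \<in> lmeasurable"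
      "measure lebesgue V \<le> 4 ^ CARD('n) * measure lebesgue A + e"
      using lipschitz_image_measure_cover[OF lip4 Am e] by auto
    have "\<exists>W. g (2 * s * real k) ` (N \<inter> Sh k) \<subseteq> W \<and> W \<in> lmeasurable \<and>
      measure lebesgue W \<le> measure lebesgue (N \<inter> Sh k) + e" for k
      using lipschitz_image_measure_cover[OF lip1 NSh e, of "2 * s * real k" k] s
      by (metis (no_types) mult_1 power_one mult_nonneg_nonneg less_eq_real_def of_nat_0_le_iff zero_le_numeral)
    then obtain W where W: "\<And>k. g (2 * s * real k) ` (N \<inter> Sh k) \<subseteq> W k"
      "\<And>k. W k \<in> lmeasurable"
      "\<And>k. measure lebesgue (W k) \<le> measure lebesgue (N \<inter> Sh k) + e"
      by metis
    have cover: "ball 0 (2 * s) \<subseteq> V \<union> (\<Union>k<m. W k)"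
    proof
      fix x :: "real ^ 'n" assume "x \<in> ball 0 (2 * s)"
      then consider "x \<in> (\<lambda>z. 4 *\<^sub>R g (r / 2) z) ` A"
        | k where "x \<in> g (2 * s * real k) ` (N \<inter> Sh k)"
        using radial_transport_cover[OF D s, of x]
        unfolding N_def A_def Sh_def g_def by blast
      then show "x \<in> V \<union> (\<Union>k<m. W k)"
      proof cases
        case 1
        then show ?thesis using V(1) by blast
      next
        case 2
        then have "k < m" using empty[of k] by (metis empty_iff image_empty not_le)
        then show ?thesis using 2 W(1) by blast
      qed
    qed
    have Wm: "(\<Union>k<m. W k) \<in> lmeasurable" using W(2) by (intro fmeasurable.finite_UN) auto
    have "measure lebesgue (ball (0 :: real ^ 'n) (2 * s)) \<le> measure lebesgue (V \<union> (\<Union>k<m. W k))"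
      using cover V(2) Wm by (intro measure_mono_fmeasurable fmeasurable.Un) auto
    also have "\<dots> \<le> measure lebesgue V + measure lebesgue (\<Union>k<m. W k)"
      using V(2) Wm by (intro measure_Un_le fmeasurableD)
    also have "measure lebesgue (\<Union>k<m. W k) \<le> (\<Sum>k<m. measure lebesgue (W k))"
      using W(2) by (intro measure_UNION_le fmeasurableD) auto
    also have "\<dots> \<le> (\<Sum>k<m. measure lebesgue (N \<inter> Sh k) + e)"
      using W(3) by (rule sum_mono)
    also have "\<dots> = measure lebesgue (\<Union>k<m. N \<inter> Sh k) + real m * e"
    proof (subst measure_UNION')
      show "pairwise (\<lambda>i j. disjnt (N \<inter> Sh i) (N \<inter> Sh j)) {..<m}"
        unfolding pairwise_def by (metis Int_lower2 disj disjnt_subset1 disjnt_subset2 disjnt_sym linorder_neqE_nat)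
    qed (use NSh in \<open>auto simp: sum.distrib\<close>)
    also have "measure lebesgue (\<Union>k<m. N \<inter> Sh k) \<le> measure lebesgue N"
      using Nm NSh by (intro measure_mono_fmeasurable sets.finite_UN) auto
    finally show ?thesis using V(3) by (simp add: algebra_simps)
  qed note bound = this
  have "measure lebesgue (ball (0 :: real ^ 'n) (2 * s)) \<le>
     4 ^ CARD('n) * measure lebesgue A + measure lebesgue N"
  proof (rule field_le_epsilon)
    fix e :: real assume "e > 0"
    then show "measure lebesgue (ball (0 :: real ^ 'n) (2 * s)) \<le>
     4 ^ CARD('n) * measure lebesgue A + measure lebesgue N + e"
      using bound[of "e / real (m + 1)"] by simp
  qed
  then show ?thesis by (simp add: A_def N_def)
qed

text \<open>
  The volume inequality behind minimality, by letting \<open>s\<close> tend to \<open>r\<close>. The constant \<open>4\<^sup>n\<close> comes from the stretching of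
  \<open>(r/2, r)\<close> onto \<open>(0, 2r)\<close>.
\<close>
proposition ball_le_thickened_frontier:
  fixes D :: "(real ^ 'n) set"
  assumes D: "bounded D" and r: "0 < r"
  shows "measure lebesgue (ball (0 :: real ^ 'n) (2 * r)) \<le>
     4 ^ CARD('n) * measure lebesgue (annulus r - closure D) +
     measure lebesgue (thickening (frontier D) r)" (is "_ \<le> ?M")
proof -
  define b where "b = measure lebesgue (ball (0 :: real ^ 'n) 1)"
  have vol: "measure lebesgue (ball (0 :: real ^ 'n) (2 * s)) = (2 * s) ^ CARD('n) * b" if "s > 0" for s
    using content_ball_conv_unit_ball[of "2 * s" "0 :: real ^ 'n"] that by (simp add: b_def)
  have "((\<lambda>s. (2 * s) ^ CARD('n) * b) \<longlongrightarrow> (2 * r) ^ CARD('n) * b) (at_left r)"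
    by (intro tendsto_intros)
  moreover have "\<forall>\<^sub>F s in at_left r. (2 * s) ^ CARD('n) * b \<le> ?M"
    using eventually_at_left_real[OF r]
    by eventually_elim (use smaller_ball_le_thickened_frontier[OF D] vol in auto)
  ultimately have "(2 * r) ^ CARD('n) * b \<le> ?M"
    by (rule tendsto_upperbound) simp
  then show ?thesis using vol[OF r] by simp
qed

section \<open>Minimality of the annulus with arbitrary filling\<close>

lemma interior_subset_density_one_points: "interior E \<subseteq> density_one_points E"
proof
  fix x assume "x \<in> interior E"
  then obtain d where d: "d > 0" "ball x d \<subseteq> E" by (auto simp: mem_interior)
  have "\<forall>\<^sub>F \<rho> in at_right 0. measure lebesgue (E \<inter> ball x \<rho>) / measure lebesgue (ball x \<rho>) = 1"
    using eventually_at_right_real[OF d(1)]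
  proof eventually_elim
    case (elim \<rho>)
    then have "E \<inter> ball x \<rho> = ball x \<rho>" using d(2) by auto
    then show ?case using elim content_ball_pos[of \<rho> x] by simp
  qed
  then show "x \<in> density_one_points E"
    unfolding density_one_points_def by (simp add: tendsto_eventually)
qed

lemma density_one_points_subset_closure: "density_one_points E \<subseteq> closure E"
proof (rule ccontr)
  assume "\<not> ?thesis"
  then obtain x where x: "x \<in> density_one_points E" "x \<notin> closure E" by blast
  then obtain d where d: "d > 0" "\<forall>y\<in>E. \<not> dist y x < d"
    unfolding closure_approachable by auto
  have "\<forall>\<^sub>F \<rho> in at_right 0. measure lebesgue (E \<inter> ball x \<rho>) / measure lebesgue (ball x \<rho>) = 0"
    using eventually_at_right_real[OF d(1)]
  proof eventually_elim
    case (elim \<rho>)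
    then have "E \<inter> ball x \<rho> = {}" using d(2) by (force simp: dist_commute)
    then show ?case by simp
  qed
  then have "((\<lambda>\<rho>. measure lebesgue (E \<inter> ball x \<rho>) / measure lebesgue (ball x \<rho>)) \<longlongrightarrow> 0) (at_right 0)"
    by (rule tendsto_eventually)
  with x(1) show False
    unfolding density_one_points_def
    using tendsto_unique trivial_limit_at_right_real zero_neq_one by blast
qed

lemma meas_boundary_subset_closure: "meas_boundary E \<subseteq> closure E"
  using closure_mono[OF density_one_points_subset_closure[of E]]
  unfolding meas_boundary_def frontier_def by auto

lemma lmeasurable_thickening_meas_boundary:
  assumes "bounded E"
  shows "thickening (meas_boundary E) r \<in> lmeasurable"
proof (rule lmeasurable_open[OF bounded_thickening open_thickening])
  show "bounded (meas_boundary E)"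
    using assms meas_boundary_subset_closure bounded_closure bounded_subset by blast
qed

lemma energy_bounded:
  assumes "bounded E" "0 < r"
  shows "energy r K E = ereal (measure lebesgue (thickening (meas_boundary E) r) / (2 * r) -
     K * measure lebesgue (E \<inter> annulus r))"
  unfolding energy_def Per_def
  using assms lmeasurable_thickening_meas_boundary[OF assms(1)]
  by (simp add: emeasure_eq_measure2 divide_ennreal enn2ereal_ennreal)

text \<open>
  The boundary of \<open>annulus r \<union> U\<close> stays in the closed ball of radius \<open>r\<close>, so its perimeter is at
  most \<open>|B\<^bsub>2r\<^esub>| / (2r)\<close>, while its reward is the largest possible. By the volume inequality,
  a competitor can lower the perimeter by at most \<open>4\<^sup>n |A - E| / (2r)\<close>, and loses \<open>K |A - E|\<close>.
\<close>
proposition minimizes_energy_annulus_Un: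
  fixes U :: "(real ^ 'n) set"
  assumes r: "0 < r" and K: "4 ^ CARD('n) / 2 / r \<le> K" and U: "U \<subseteq> ball 0 (r / 2)"
  shows "minimizes_energy r K (annulus r \<union> U)"
  unfolding minimizes_energy_def
proof (intro allI impI)
  fix E :: "(real ^ 'n) set"
  assume E: "E \<in> sets lebesgue \<and> bounded E"
  define M where "M = annulus r \<union> U"
  have M: "M \<subseteq> cball 0 r" using U r by (auto simp: M_def annulus_def)
  then have Mb: "bounded M" using bounded_cball bounded_subset by blast
  define D where "D = density_one_points E"
  have "D \<subseteq> closure E" unfolding D_def by (rule density_one_points_subset_closure)
  then have Db: "bounded D" using E bounded_closure bounded_subset by blast
  define NE where "NE = measure lebesgue (thickening (meas_boundary E) r)"
  define NM where "NM = measure lebesgue (thickening (meas_boundary M) r)"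
  have "thickening (meas_boundary M) r \<subseteq> ball 0 (2 * r)"
  proof
    fix x assume "x \<in> thickening (meas_boundary M) r"
    then obtain y where y: "y \<in> meas_boundary M" "dist y x < r" by (auto simp: thickening_def)
    have "y \<in> cball 0 r"
      using y(1) meas_boundary_subset_closure closure_minimal[OF M closed_cball] by blast
    then show "x \<in> ball 0 (2 * r)" using y(2) dist_triangle[of 0 x y] by simp
  qed
  then have "NM \<le> measure lebesgue (ball (0 :: real ^ 'n) (2 * r))"
    unfolding NM_def using lmeasurable_thickening_meas_boundary[OF Mb]
    by (intro measure_mono_fmeasurable fmeasurableD) auto
  also have "\<dots> \<le> 4 ^ CARD('n) * measure lebesgue (annulus r - closure D) + NE"
    using ball_le_thickened_frontier[OF Db r] unfolding NE_def D_def meas_boundary_def .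
  also have "measure lebesgue (annulus r - closure D) \<le> measure lebesgue (annulus r - E)"
  proof -
    have neg: "negligible (E - D)" unfolding D_def using E lebesgue_density by blast
    have AE: "annulus r - E \<in> lmeasurable"
      using E by (intro fmeasurable_Diff lmeasurable_annulus) auto
    have "annulus r - closure D \<subseteq> (annulus r - E) \<union> (E - D)"
      using closure_subset by blast
    moreover have "annulus r - closure D \<in> sets lebesgue"
      using lmeasurable_annulus[of r, THEN fmeasurableD] by (intro sets.Diff) auto
    ultimately have "measure lebesgue (annulus r - closure D) \<le> measure lebesgue ((annulus r - E) \<union> (E - D))"
      using AE negligible_imp_measurable[OF neg]
      by (intro measure_mono_fmeasurable fmeasurable.Un) auto
    also have "\<dots> \<le> measure lebesgue (annulus r - E) + measure lebesgue (E - D)"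
      using fmeasurableD[OF AE] negligible_imp_sets[OF neg] by (rule measure_Un_le)
    finally show ?thesis using negligible_imp_measure0[OF neg] by simp
  qed
  finally have N: "NM \<le> 4 ^ CARD('n) * measure lebesgue (annulus r - E) + NE" by simp
  have "measure lebesgue (annulus r :: (real ^ 'n) set) = 
      measure lebesgue (E \<inter> annulus r) + measure lebesgue (annulus r - E)"
    using measure_Int_add_Diff[OF lmeasurable_annulus, of E] E by (simp add: Int_commute)
  moreover have "M \<inter> annulus r = annulus r" by (auto simp: M_def)
  moreover have "4 ^ CARD('n) / (2 * r) * measure lebesgue (annulus r - E) \<le> K * measure lebesgue (annulus r - E)"
    using K by (intro mult_right_mono) (auto simp: field_simps)
  moreover have "NM / (2 * r) \<le> (4 ^ CARD('n) * measure lebesgue (annulus r - E) + NE) / (2 * r)"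
    using N r by (intro divide_right_mono) auto
  ultimately have "NM / (2 * r) - K * measure lebesgue (M \<inter> annulus r) \<le>
     NE / (2 * r) - K * measure lebesgue (E \<inter> annulus r)"
    by (simp add: add_divide_distrib algebra_simps)
  then show "energy r K (annulus r \<union> U) \<le> energy r K E"
    using energy_bounded[OF Mb r] energy_bounded[of E, OF _ r] E unfolding NM_def NE_def M_def by simp
qed

section \<open>A minimizer whose boundary is not a graph\<close>

lemma meas_boundary_meets_ray_segment:
  assumes "a < b" "b *\<^sub>R \<nu> \<in> interior E" "a *\<^sub>R \<nu> \<notin> closure E"
  obtains u where "a \<le> u" "u \<le> b" "u *\<^sub>R \<nu> \<in> meas_boundary E"
proof -
  define R where "R = (\<lambda>u. u *\<^sub>R \<nu>) ` {a..b}"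
  have "connected R"
    unfolding R_def by (intro connected_continuous_image continuous_intros) auto
  moreover have "b *\<^sub>R \<nu> \<in> R \<inter> density_one_points E"
    using assms interior_subset_density_one_points by (auto simp: R_def)
  then have "R \<inter> density_one_points E \<noteq> {}" by blast
  moreover have "a *\<^sub>R \<nu> \<in> R - density_one_points E"
    using assms density_one_points_subset_closure by (auto simp: R_def)
  then have "R - density_one_points E \<noteq> {}" by blast
  ultimately have "R \<inter> meas_boundary E \<noteq> {}"
    unfolding meas_boundary_def by (rule connected_Int_frontier)
  then show thesis using that by (auto simp: R_def)
qed

text \<open>
  The origin is a limit point of \<open>S\<close>, hence in \<open>S\<close>. A graph over the hyperplane orthogonal to \<open>\<nu>\<close>
  meets the line through \<open>0\<close> in direction \<open>\<nu>\<close> in one point only, but \<open>S\<close> contains a second one close to \<open>0\<close>.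
\<close>
lemma not_locally_continuous_graph_if_rays:
  assumes S: "closed S"
    and rays: "\<And>\<nu> \<delta>. \<lbrakk>norm (\<nu> :: real ^ 'n) = 1; 0 < \<delta>\<rbrakk> \<Longrightarrow> \<exists>u>0. u < \<delta> \<and> u *\<^sub>R \<nu> \<in> S"
  shows "\<not> locally_continuous_graph S"
proof
  assume graph: "locally_continuous_graph S"
  obtain \<theta> :: "real ^ 'n" where \<theta>: "norm \<theta> = 1" using vector_choose_size[of 1] by auto
  have "\<exists>y\<in>S. dist y 0 < \<delta>" if "\<delta> > 0" for \<delta>
  proof -
    obtain u where "u > 0" "u < \<delta>" "u *\<^sub>R \<theta> \<in> S" using rays[OF \<theta> \<open>\<delta> > 0\<close>] by blast
    then show ?thesis using \<theta> by (intro bexI[of _ "u *\<^sub>R \<theta>"]) auto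
  qed
  then have "0 \<in> closure S" by (simp add: closure_approachable)
  then have "0 \<in> S" using S by simp
  then have "\<exists>\<nu> V W g. norm \<nu> = 1 \<and> open V \<and> 0 \<in> V \<and>
        openin (top_of_set {y. \<nu> \<bullet> y = 0}) W \<and> continuous_on W (g :: real ^ 'n \<Rightarrow> real) \<and>
        S \<inter> V = {y + g y *\<^sub>R \<nu> | y. y \<in> W}"
    using graph unfolding locally_continuous_graph_def by (rule bspec[rotated])
  then obtain \<nu> V W and g :: "real ^ 'n \<Rightarrow> real" where \<nu>: "norm \<nu> = 1"
    and V: "open V" "0 \<in> V" and W: "openin (top_of_set {y. \<nu> \<bullet> y = 0}) W"
    and g: "S \<inter> V = {y + g y *\<^sub>R \<nu> | y. y \<in> W}"
    by (elim exE conjE)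
  have height: "g 0 = u" if "u *\<^sub>R \<nu> \<in> S \<inter> V" for u
  proof -
    obtain y where y: "y \<in> W" "u *\<^sub>R \<nu> = y + g y *\<^sub>R \<nu>" using \<open>u *\<^sub>R \<nu> \<in> S \<inter> V\<close> unfolding g by blast
    have "\<nu> \<bullet> y = 0" using openin_imp_subset[OF W] y(1) by auto
    moreover have "\<nu> \<bullet> \<nu> = 1" using \<nu> by (simp add: dot_square_norm)
    ultimately have "u = g y" using arg_cong[OF y(2), of "\<lambda>z. \<nu> \<bullet> z"] by (simp add: inner_add_right)
    then show ?thesis using y(2) by simp
  qed
  obtain \<delta> where \<delta>: "\<delta> > 0" "ball 0 \<delta> \<subseteq> V" using V openE by blast
  obtain u where u: "0 < u" "u < \<delta>" "u *\<^sub>R \<nu> \<in> S" using rays[OF \<nu> \<delta>(1)] by blast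
  have "u *\<^sub>R \<nu> \<in> V" using \<delta>(2) u \<nu> by auto
  then have "g 0 = u" using u(3) by (intro height) simp
  moreover have "g 0 = 0" using \<open>0 \<in> S\<close> V(2) by (intro height) simp
  ultimately show False using u(1) by simp
qed

text \<open>
  Concentric open shells, separated by gaps, that accumulate at the origin.
\<close>
definition sine_shells :: "real \<Rightarrow> (real ^ 'n) set" where
  "sine_shells r = {x \<in> ball 0 (r / 2) - {0}. 0 < sin (1 / norm x)}"

text \<open>
  Used with the sine for the shells and with its negative for the gaps between them.
\<close>
lemma open_oscillating_shells:
  fixes f :: "real \<Rightarrow> real"
  assumes "continuous_on UNIV f"
  shows "open {x \<in> ball 0 (r / 2) - {0 :: real ^ 'n}. 0 < f (1 / norm x)}"
proof -
  have "open ((ball 0 (r / 2) - {0 :: real ^ 'n}) \<inter> (\<lambda>x. f (1 / norm x)) -` {0<..})"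
    by (intro continuous_open_preimage continuous_on_compose2[OF assms] continuous_intros) auto
  also have "(ball 0 (r / 2) - {0}) \<inter> (\<lambda>x. f (1 / norm x)) -` {0<..} =
     {x \<in> ball 0 (r / 2) - {0 :: real ^ 'n}. 0 < f (1 / norm x)}" by auto
  finally show ?thesis .
qed

lemma open_sine_shells: "open (sine_shells r)"
  unfolding sine_shells_def by (intro open_oscillating_shells continuous_intros)

lemma sine_shells_not_locally_continuous_graph:
  fixes M :: "(real ^ 'n) set"
  assumes r: "0 < r"
  defines "M \<equiv> annulus r \<union> sine_shells r"
  shows "\<not> locally_continuous_graph (meas_boundary M)"
proof (rule not_locally_continuous_graph_if_rays)
  show "closed (meas_boundary M)" by (simp add: meas_boundary_def)
next
  fix \<nu> :: "real ^ 'n" and \<delta> :: real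
  assume \<nu>: "norm \<nu> = 1" and \<delta>: "0 < \<delta>"
  define e where "e = min \<delta> (r / 2)"
  have \<nu>0: "\<nu> \<noteq> 0" using \<nu> by auto
  have e: "0 < e" "e \<le> \<delta>" "e \<le> r / 2" using \<delta> r by (auto simp: e_def)
  obtain k :: nat where k: "1 / e < real k" using reals_Archimedean2 by blast
  \<comment> \<open>At radius \<open>1/p\<close> the sine equals \<open>1\<close>, inside a shell; at radius \<open>1/(p + \<pi>)\<close> it equals \<open>-1\<close>,
    inside a gap. The boundary is crossed in between.\<close>
  define p where "p = 2 * real k * pi + pi / 2"
  have sins: "sin p = 1" "sin (p + pi) = -1"
    unfolding p_def sin_periodic_pi by (simp_all add: sin_add sin_2npi cos_2npi)
  have "1 / e < p"
  proof -
    have "real k * 1 \<le> real k * (2 * pi)" using pi_gt3 by (intro mult_left_mono) auto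
    then show ?thesis using k pi_gt_zero unfolding p_def by linarith
  qed
  moreover have "0 < p" using pi_gt_zero by (simp add: p_def add_nonneg_pos)
  ultimately have p: "0 < p" "1 / p < e" using e by (simp_all add: field_simps)
  have q: "0 < p + pi" "1 / (p + pi) < 1 / p" using p pi_gt_zero
    by (auto intro!: divide_strict_left_mono mult_pos_pos add_pos_pos)
  have "(1 / p) *\<^sub>R \<nu> \<in> sine_shells r"
    using p q \<nu> \<nu>0 e sins by (simp add: sine_shells_def)
  then have inner: "(1 / p) *\<^sub>R \<nu> \<in> interior M"
    using open_sine_shells by (intro interiorI[of "sine_shells r"]) (auto simp: M_def)
  let ?G = "{x \<in> ball 0 (r / 2) - {0 :: real ^ 'n}. 0 < - sin (1 / norm x)}"
  have "open ?G" by (intro open_oscillating_shells continuous_intros)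
  moreover have "?G \<inter> M = {}" by (auto simp: M_def sine_shells_def annulus_def)
  ultimately have "?G \<inter> closure M = {}" by (simp add: open_Int_closure_eq_empty)
  moreover have "(1 / (p + pi)) *\<^sub>R \<nu> \<in> ?G"
    using p q \<nu> \<nu>0 e sins by simp
  ultimately have outer: "(1 / (p + pi)) *\<^sub>R \<nu> \<notin> closure M" by blast
  obtain u where u: "1 / (p + pi) \<le> u" "u \<le> 1 / p" "u *\<^sub>R \<nu> \<in> meas_boundary M"
    using meas_boundary_meets_ray_segment[OF q(2) inner outer] .
  have "0 < 1 / (p + pi)" using q by simp
  then have "0 < u" "u < \<delta>" using u(1,2) p(2) e(2) by linarith+
  with u(3) show "\<exists>u>0. u < \<delta> \<and> u *\<^sub>R \<nu> \<in> meas_boundary M" by blast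
qed

section \<open>A sequence of minimizers without convergent subsequence\<close>

text \<open>
  The points whose \<open>i\<close>-th coordinate, in units of \<open>1/\<beta>\<close>, has \<open>1\<close> as its \<open>k\<close>-th binary digit after the point.
\<close>
definition binary_digit_set :: "real \<Rightarrow> 'n \<Rightarrow> nat \<Rightarrow> (real ^ 'n) set" where
  "binary_digit_set \<beta> i k = {x. odd \<lfloor>2 ^ k * \<beta> * x $ i\<rfloor>}"

lemma sets_binary_digit_set: "binary_digit_set \<beta> i k \<in> sets lebesgue"
proof -
  have "binary_digit_set \<beta> i k \<in> sets borel"
    unfolding binary_digit_set_def by measurable
  then show ?thesis by simp
qed

text \<open>
  Shifting by one unit of the \<open>k\<close>-th digit flips that digit and, being an even multiple of the finer
  units, preserves all later ones.
\<close>
lemma binary_digit_set_shift: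
  fixes x :: "real ^ 'n"
  assumes "0 < \<beta>" "k \<le> j"
  shows "x + axis i (1 / (2 ^ k * \<beta>)) \<in> binary_digit_set \<beta> i j \<longleftrightarrow>
     (x \<in> binary_digit_set \<beta> i j \<longleftrightarrow> k < j)"
proof -
  have "(2 :: real) ^ j = 2 ^ k * 2 ^ (j - k)"
    using assms(2) by (simp flip: power_add)
  then have "2 ^ j * \<beta> * (x + axis i (1 / (2 ^ k * \<beta>))) $ i = 2 ^ j * \<beta> * x $ i + of_int (2 ^ (j - k))"
    using assms(1) by (simp add: axis_def field_simps)
  then have "\<lfloor>2 ^ j * \<beta> * (x + axis i (1 / (2 ^ k * \<beta>))) $ i\<rfloor> = \<lfloor>2 ^ j * \<beta> * x $ i\<rfloor> + 2 ^ (j - k)"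
    by (simp only: floor_add_int)
  then show ?thesis using assms(2) by (auto simp: binary_digit_set_def)
qed

text \<open>
  The shift by one unit of the \<open>k\<close>-th digit exchanges the set \<open>P\<close>, where digits \<open>k\<close> and \<open>j\<close>
  differ, with its complement. So the points of the smaller ball outside \<open>P\<close> are carried
  into the part of \<open>P\<close> in the larger ball, and \<open>P\<close> fills at least half of the smaller volume.
\<close>
lemma binary_digit_sets_far_apart:
  fixes i :: "'n::finite"
  assumes "0 < \<beta>" "k < j"
  defines "P \<equiv> {x :: real ^ 'n. x \<in> binary_digit_set \<beta> i k \<longleftrightarrow> x \<notin> binary_digit_set \<beta> i j}"
  shows "measure lebesgue (ball (0 :: real ^ 'n) a) \<le> 2 * measure lebesgue (ball 0 (a + 1 / \<beta>) \<inter> P)"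
proof -
  define v :: "real ^ 'n" where "v = axis i (1 / (2 ^ k * \<beta>))"
  have "P = (binary_digit_set \<beta> i k - binary_digit_set \<beta> i j) \<union> (binary_digit_set \<beta> i j - binary_digit_set \<beta> i k)"
    by (auto simp: P_def)
  then have P: "P \<in> sets lebesgue" by (simp only: sets.Un sets.Diff sets_binary_digit_set)
  have "1 / (2 ^ k * \<beta>) \<le> 1 / \<beta>"
    using assms(1) by (intro divide_left_mono) auto
  moreover have "v = (1 / (2 ^ k * \<beta>)) *\<^sub>R axis i 1" by (simp add: v_def vec_eq_iff axis_def)
  ultimately have v: "norm v \<le> 1 / \<beta>" using assms(1) by simp
  have flip: "x + v \<in> P \<longleftrightarrow> x \<notin> P" for x
    using binary_digit_set_shift[OF assms(1), of k k x i]
      binary_digit_set_shift[OF assms(1), of k j x i] assms(2)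
    by (auto simp: P_def v_def)
  let ?Q = "ball (0 :: real ^ 'n) a" and ?R = "ball (0 :: real ^ 'n) (a + 1 / \<beta>)"
  have QR: "?Q \<subseteq> ?R" using assms(1) by (intro subset_ball) simp
  have RP: "?R \<inter> P \<in> lmeasurable" using P by (intro fmeasurable_Int_fmeasurable) auto
  have QP: "?Q \<inter> P \<in> lmeasurable" "?Q - P \<in> lmeasurable"
    using P by (auto intro: fmeasurable_Int_fmeasurable fmeasurable_Diff)
  have "measure lebesgue ?Q = measure lebesgue (?Q \<inter> P) + measure lebesgue (?Q - P)"
    using measure_Int_add_Diff[OF _ P, of ?Q] by simp
  also have "measure lebesgue (?Q \<inter> P) \<le> measure lebesgue (?R \<inter> P)"
    using fmeasurableD[OF QP(1)] QR by (intro measure_mono_fmeasurable RP) auto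
  also have "measure lebesgue (?Q - P) = measure lebesgue ((+) v ` (?Q - P))"
    by (simp add: measure_translation)
  also have "\<dots> \<le> measure lebesgue (?R \<inter> P)"
  proof (intro measure_mono_fmeasurable RP)
    show "(+) v ` (?Q - P) \<subseteq> ?R \<inter> P"
    proof (rule image_subsetI)
      fix x assume x: "x \<in> ?Q - P"
      then have "norm (v + x) < a + 1 / \<beta>"
        using v norm_triangle_ineq[of v x] by simp
      moreover have "v + x \<in> P" using x flip[of x] by (simp add: add.commute)
      ultimately show "v + x \<in> ?R \<inter> P" by simp
    qed
    show "(+) v ` (?Q - P) \<in> sets lebesgue"
      using QP(2) measurable_translation by (blast intro: fmeasurableD)
  qed
  finally show ?thesis by simp
qed

text \<open>
  If a subsequence converged to \<open>g\<close>, consecutive members would both be close to \<open>g\<close> in \<open>L\<^sup>1\<close>, but the triangle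
  inequality keeps the sum of their distances to \<open>g\<close> above \<open>c\<close>.
\<close>
lemma not_precompact_L1_if_separated:
  fixes E :: "nat \<Rightarrow> (real ^ 'n) set"
  assumes \<Omega>: "\<Omega> \<in> sets lebesgue" and E: "\<And>k. E k \<in> sets lebesgue" and c: "0 < c"
    and sep: "\<And>j k. k < j \<Longrightarrow> c \<le> emeasure lebesgue {x \<in> \<Omega>. x \<in> E k \<longleftrightarrow> x \<notin> E j}"
  shows "\<not> precompact_L1 \<Omega> (range (\<lambda>k. indicator (E k)))"
proof
  assume "precompact_L1 \<Omega> (range (\<lambda>k. indicator (E k)))"
  then have "range (\<lambda>k. indicator (E k)) \<subseteq> range (\<lambda>k. indicator (E k) :: real ^ 'n \<Rightarrow> real) \<longrightarrow>
    (\<exists>g s. set_integrable lebesgue \<Omega> g \<and> strict_mono s \<and>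
      (\<lambda>k. \<integral>\<^sup>+x\<in>\<Omega>. ennreal \<bar>indicator (E (s k)) x - g x\<bar> \<partial>lebesgue) \<longlonglongrightarrow> 0)"
    unfolding precompact_L1_def by (rule spec)
  then obtain g :: "real ^ 'n \<Rightarrow> real" and s :: "nat \<Rightarrow> nat"
    where g: "set_integrable lebesgue \<Omega> g" and s: "strict_mono s"
      and lim: "(\<lambda>k. \<integral>\<^sup>+x\<in>\<Omega>. ennreal \<bar>indicator (E (s k)) x - g x\<bar> \<partial>lebesgue) \<longlonglongrightarrow> 0"
    by auto
  define X where "X k = (\<integral>\<^sup>+x\<in>\<Omega>. ennreal \<bar>indicator (E k) x - g x\<bar> \<partial>lebesgue)" for k
  have meas: "(\<lambda>x. ennreal \<bar>indicator (E k) x - g x\<bar> * indicator \<Omega> x) \<in> borel_measurable lebesgue" for k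
  proof -
    have "(\<lambda>x. indicator \<Omega> x *\<^sub>R g x) \<in> borel_measurable lebesgue"
      using g unfolding set_integrable_def by (rule borel_measurable_integrable)
    then have "(\<lambda>x. ennreal \<bar>indicator \<Omega> x * indicator (E k) x - indicator \<Omega> x *\<^sub>R g x\<bar>)
      \<in> borel_measurable lebesgue"
      using \<Omega> E by measurable
    also have "(\<lambda>x. ennreal \<bar>indicator \<Omega> x * indicator (E k) x - indicator \<Omega> x *\<^sub>R g x\<bar>) =
      (\<lambda>x. ennreal \<bar>indicator (E k) x - g x\<bar> * indicator \<Omega> x)"
      by (auto simp: indicator_def)
    finally show ?thesis .
  qed
  have lower: "c \<le> X k + X j" if "k < j" for k j
  proof -
    let ?P = "{x \<in> \<Omega>. x \<in> E k \<longleftrightarrow> x \<notin> E j}"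
    have "?P = \<Omega> \<inter> ((E k - E j) \<union> (E j - E k))" by auto
    then have P: "?P \<in> sets lebesgue" using \<Omega> E by (simp only: sets.Int sets.Un sets.Diff)
    have "c \<le> (\<integral>\<^sup>+x. indicator ?P x \<partial>lebesgue)" using sep[OF that] P by simp
    also have "\<dots> \<le> (\<integral>\<^sup>+x. ennreal \<bar>indicator (E k) x - g x\<bar> * indicator \<Omega> x +
       ennreal \<bar>indicator (E j) x - g x\<bar> * indicator \<Omega> x \<partial>lebesgue)"
    proof (rule nn_integral_mono)
      fix x
      show "indicator ?P x \<le> ennreal \<bar>indicator (E k) x - g x\<bar> * indicator \<Omega> x +
         ennreal \<bar>indicator (E j) x - g x\<bar> * indicator \<Omega> x"
      proof (cases "x \<in> ?P")
        case True
        then have "1 \<le> \<bar>indicator (E k) x - g x\<bar> + \<bar>indicator (E j) x - g x\<bar>"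
          by (auto simp: indicator_def split: if_splits)
        then have "1 \<le> ennreal \<bar>indicator (E k) x - g x\<bar> + ennreal \<bar>indicator (E j) x - g x\<bar>"
          by (simp flip: ennreal_plus)
        with True show ?thesis by simp
      qed simp
    qed
    also have "\<dots> = X k + X j"
      unfolding X_def by (intro nn_integral_add meas)
    finally show ?thesis .
  qed
  have "(\<lambda>k. X (s k) + X (s (Suc k))) \<longlonglongrightarrow> 0 + 0"
    using lim LIMSEQ_Suc[OF lim] unfolding X_def by (rule tendsto_add)
  then have "c \<le> 0 + 0"
    by (rule tendsto_lowerbound) (use lower s in \<open>auto simp: strict_mono_Suc_iff\<close>)
  with c show False by simp
qed

section \<open>Existence of irregular and non-compact minimizers\<close>

theorem theorem1p19:
  "\<exists>C>0. \<forall>r>0. \<forall>K>0. K \<ge> C / r \<longrightarrow>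
     (\<exists>M :: (real ^ 'n) set. M \<in> sets lebesgue \<and> minimizes_energy r K M \<and>
        \<not> locally_continuous_graph (meas_boundary M)) \<and>
     (\<forall>U :: (real ^ 'n) set. U \<in> sets lebesgue \<and> U \<subseteq> ball 0 (r / 2) \<longrightarrow>
        minimizes_energy r K (annulus r \<union> U)) \<and>
     (\<exists>E :: nat \<Rightarrow> (real ^ 'n) set. (\<forall>k. E k \<in> sets lebesgue \<and> minimizes_energy r K (E k)) \<and>
        \<not> precompact_L1 (ball 0 r) (range (\<lambda>k. indicator (E k))))"
proof (intro exI[of _ "4 ^ CARD('n) / 2"] conjI allI impI)
  show "(0 :: real) < 4 ^ CARD('n) / 2" by simp
next
  fix r K :: real
  assume "0 < r" "0 < K" and K: "4 ^ CARD('n) / 2 / r \<le> K"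
  note minimizer = minimizes_energy_annulus_Un[OF \<open>0 < r\<close> K]
  have meas: "annulus r \<union> U \<in> sets lebesgue" if "U \<in> sets lebesgue" for U :: "(real ^ 'n) set"
    using that fmeasurableD[OF lmeasurable_annulus] by (rule sets.Un[rotated])
  show "\<exists>M :: (real ^ 'n) set. M \<in> sets lebesgue \<and> minimizes_energy r K M \<and>
        \<not> locally_continuous_graph (meas_boundary M)"
  proof (intro exI conjI)
    show "annulus r \<union> sine_shells r \<in> sets (lebesgue :: (real ^ 'n) measure)"
    proof (rule meas)
      have "sine_shells r \<in> sets (borel :: (real ^ 'n) measure)"
        using open_sine_shells by (rule borel_open)
      then show "sine_shells r \<in> sets (lebesgue :: (real ^ 'n) measure)" by simp
    qed
    show "minimizes_energy r K (annulus r \<union> sine_shells r :: (real ^ 'n) set)"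
      by (rule minimizer) (auto simp: sine_shells_def)
    show "\<not> locally_continuous_graph (meas_boundary (annulus r \<union> sine_shells r :: (real ^ 'n) set))"
      using \<open>0 < r\<close> by (rule sine_shells_not_locally_continuous_graph)
  qed
  show "minimizes_energy r K (annulus r \<union> U)"
    if "U \<in> sets lebesgue \<and> U \<subseteq> ball 0 (r / 2)" for U :: "(real ^ 'n) set"
    using that by (intro minimizer) simp
  fix i :: 'n
  \<comment> \<open>With unit \<open>r/4\<close>, all shifts are at most \<open>r/4\<close> long and keep the ball of radius \<open>r/4\<close> inside that
    of radius \<open>r/2\<close>.\<close>
  define U where "U k = ball 0 (r / 2) \<inter> binary_digit_set (4 / r) i k" for k
  define E where "E k = annulus r \<union> U k" for k
  show "\<exists>E :: nat \<Rightarrow> (real ^ 'n) set. (\<forall>k. E k \<in> sets lebesgue \<and> minimizes_energy r K (E k)) \<and>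
        \<not> precompact_L1 (ball 0 r) (range (\<lambda>k. indicator (E k)))"
  proof (intro exI conjI allI)
    show E: "E k \<in> sets lebesgue" for k
      unfolding E_def U_def by (intro meas sets.Int sets_binary_digit_set) simp
    show "minimizes_energy r K (E k)" for k
      unfolding E_def by (rule minimizer) (auto simp: U_def)
    define c where "c = measure lebesgue (ball (0 :: real ^ 'n) (r / 4)) / 2"
    show "\<not> precompact_L1 (ball 0 r) (range (\<lambda>k. indicator (E k)))"
    proof (rule not_precompact_L1_if_separated[OF _ E])
      show "0 < ennreal c"
        using content_ball_pos[of "r / 4" "0 :: real ^ 'n"] \<open>0 < r\<close> by (simp add: c_def)
      fix k j :: nat
      assume "k < j"
      let ?P = "ball 0 (r / 4 + 1 / (4 / r)) \<inter>
        {x. x \<in> binary_digit_set (4 / r) i k \<longleftrightarrow> x \<notin> binary_digit_set (4 / r) i j}"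
      let ?S = "{x \<in> ball 0 r. x \<in> E k \<longleftrightarrow> x \<notin> E j}"
      have "c \<le> measure lebesgue ?P"
        using binary_digit_sets_far_apart[of "4 / r" k j "r / 4" i] \<open>k < j\<close> \<open>0 < r\<close>
        by (simp add: c_def)
      also have "?P = ?S"
        using \<open>0 < r\<close> by (auto simp: E_def U_def annulus_def)
      finally have "c \<le> measure lebesgue ?S" .
      moreover have "?S = ball 0 r \<inter> ((E k - E j) \<union> (E j - E k))" by auto
      then have "?S \<in> lmeasurable"
        using E by (simp only: fmeasurable_Int_fmeasurable lmeasurable_ball sets.Un sets.Diff)
      ultimately show "ennreal c \<le> emeasure lebesgue ?S"
        by (simp add: emeasure_eq_measure2)
    qed simp
  qed
qed

end
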